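(* Let $X$ be an Alexandroff space with topology $\tau$, let $f:X\to X$ be a continuous self-map, and let $\mathcal{U}$ be a quasi-uniformity on $X$ that induces the topology $\tau$. Then $f$ is not sensitive to initial conditions (with respect to $\mathcal{U}$); so $f$ is not AY-chaotic, and even less so D-chaotic.
   Context: $\mathbb{N}$ is the set of non-negative integers. A topological space is an Alexandroff space if the intersection of every family of open sets is open. A quasi-uniformity $\mathcal{U}$ on $X$ is a filter on $X\times X$ such that every $U\in\mathcal{U}$ contains the diagonal and for every $U\in\mathcal{U}$ there is $W\in\mathcal{U}$ with $W\circ W\subseteq U$ (symmetry is not required). With $U(x)=\{y\in X:(x,y)\in U\}$, the topology induced by $\mathcal{U}$ is the one in which $A\subseteq X$ is open if and only if for every $x\in A$ there is $U\in\mathcal{U}$ with $U(x)\subseteq A$. For $U\in\mathcal{U}$ and $x\in X$ put $N(x,U)=\{y\in X: (f^k(x),f^k(y))\in U \text{ for all } k\in\mathbb{N}\}$. The map $f$ is sensitive to initial conditions if there exists $U\in\mathcal{U}$ such that, for all $x\in X$, $N(x,U)$ is not a neighborhood of $x$. The map $f$ is transitive if there is $x\in X$ such that for every non-empty open set $U$ and every $n\in\mathbb{N}$ there is $k\ge n$ with $f^k(x)\in U$. A point $x\in X$ is periodic if $f^k(x)=x$ for some positive integer $k$. The map $f$ is AY-chaotic (chaotic in the sense of Auslander-Yorke) if it is transitive and sensitive to initial conditions; it is D-chaotic (chaotic in the sense of Devaney) if it is transitive, sensitive to initial conditions, and its periodic points are dense in $X$. *)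

theory Defs
  imports "HOL-Analysis.Analysis"
begin

definition Alexandroff_space :: "'a topology \<Rightarrow> bool" where
  "Alexandroff_space T \<longleftrightarrow>
     (\<forall>\<A>. (\<forall>A\<in>\<A>. openin T A) \<longrightarrow> openin T (topspace T \<inter> \<Inter>\<A>))"

text \<open>
  A filter on the set \<open>X \<times> X\<close> is represented by a library filter below
  \<open>principal (X \<times> X)\<close>; its members in the sense of the set-of-sets presentation are the
  following subsets of \<open>X \<times> X\<close>.
\<close>

definition entourages :: "'a set \<Rightarrow> ('a \<times> 'a) filter \<Rightarrow> ('a \<times> 'a) set set" where
  "entourages X \<U> = {U. U \<subseteq> X \<times> X \<and> eventually (\<lambda>p. p \<in> U) \<U>}"

text \<open>
  Filters are proper (the empty set is not a member), hence the condition \<open>\<U> \<noteq> bot\<close>.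
  For nonempty \<open>X\<close> it is implied by the diagonal condition; it excludes exactly
  \<open>X = {}\<close>, for which every self-map would be vacuously sensitive.
\<close>

definition quasi_uniformity_on :: "'a set \<Rightarrow> ('a \<times> 'a) filter \<Rightarrow> bool" where
  "quasi_uniformity_on X \<U> \<longleftrightarrow>
     \<U> \<noteq> bot \<and> \<U> \<le> principal (X \<times> X) \<and>
     (\<forall>U\<in>entourages X \<U>. Id_on X \<subseteq> U) \<and>
     (\<forall>U\<in>entourages X \<U>. \<exists>W\<in>entourages X \<U>. W O W \<subseteq> U)"

text \<open>For an entourage \<open>U\<close>, the image \<open>U `` {x}\<close> is \<open>U(x)\<close>.\<close>

definition quasi_uniform_topology :: "'a set \<Rightarrow> ('a \<times> 'a) filter \<Rightarrow> 'a topology" where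
  "quasi_uniform_topology X \<U> =
     topology (\<lambda>A. A \<subseteq> X \<and> (\<forall>x\<in>A. \<exists>U\<in>entourages X \<U>. U `` {x} \<subseteq> A))"

lemma openin_quasi_uniform_topology:
  assumes "quasi_uniformity_on X \<U>"
  shows "openin (quasi_uniform_topology X \<U>) A \<longleftrightarrow>
           A \<subseteq> X \<and> (\<forall>x\<in>A. \<exists>U\<in>entourages X \<U>. U `` {x} \<subseteq> A)"
proof -
  let ?P = "\<lambda>A. A \<subseteq> X \<and> (\<forall>x\<in>A. \<exists>U\<in>entourages X \<U>. U `` {x} \<subseteq> A)"
  have Int: "U \<inter> V \<in> entourages X \<U>"
    if "U \<in> entourages X \<U>" "V \<in> entourages X \<U>" for U V
    using that by (auto simp: entourages_def eventually_conj_iff)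
  have "istopology ?P"
    unfolding istopology_def
  proof (intro conjI allI impI)
    fix S V assume S: "?P S" and V: "?P V"
    show "S \<inter> V \<subseteq> X" using S by blast
    show "\<forall>x\<in>S \<inter> V. \<exists>U\<in>entourages X \<U>. U `` {x} \<subseteq> S \<inter> V"
    proof
      fix x assume "x \<in> S \<inter> V"
      then obtain U W where "U \<in> entourages X \<U>" "U `` {x} \<subseteq> S"
        "W \<in> entourages X \<U>" "W `` {x} \<subseteq> V"
        using S V by (meson IntD1 IntD2)
      then show "\<exists>U\<in>entourages X \<U>. U `` {x} \<subseteq> S \<inter> V"
        using Int[of U W] by (intro bexI[of _ "U \<inter> W"]) auto
    qed
  next
    fix \<K> assume K: "\<forall>K\<in>\<K>. ?P K"
    show "\<Union>\<K> \<subseteq> X" using K by blast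
    show "\<forall>x\<in>\<Union>\<K>. \<exists>U\<in>entourages X \<U>. U `` {x} \<subseteq> \<Union>\<K>"
      using K by (meson Union_iff Union_upper order_trans)
  qed
  then show ?thesis
    by (simp add: quasi_uniform_topology_def topology_inverse')
qed

definition orbit_nbhd :: "'a set \<Rightarrow> ('a \<Rightarrow> 'a) \<Rightarrow> 'a \<Rightarrow> ('a \<times> 'a) set \<Rightarrow> 'a set" where
  "orbit_nbhd X f x U = {y \<in> X. \<forall>k::nat. ((f ^^ k) x, (f ^^ k) y) \<in> U}"

definition neighborhood_in :: "'a topology \<Rightarrow> 'a \<Rightarrow> 'a set \<Rightarrow> bool" where
  "neighborhood_in T x N \<longleftrightarrow> N \<subseteq> topspace T \<and> (\<exists>V. openin T V \<and> x \<in> V \<and> V \<subseteq> N)"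

definition sensitive :: "'a topology \<Rightarrow> ('a \<times> 'a) filter \<Rightarrow> ('a \<Rightarrow> 'a) \<Rightarrow> bool" where
  "sensitive T \<U> f \<longleftrightarrow>
     (\<exists>U\<in>entourages (topspace T) \<U>. \<forall>x\<in>topspace T.
        \<not> neighborhood_in T x (orbit_nbhd (topspace T) f x U))"

definition transitive_map :: "'a topology \<Rightarrow> ('a \<Rightarrow> 'a) \<Rightarrow> bool" where
  "transitive_map T f \<longleftrightarrow>
     (\<exists>x\<in>topspace T. \<forall>V n. openin T V \<and> V \<noteq> {} \<longrightarrow> (\<exists>k\<ge>n. (f ^^ k) x \<in> V))"

definition periodic_points :: "'a set \<Rightarrow> ('a \<Rightarrow> 'a) \<Rightarrow> 'a set" where
  "periodic_points X f = {x \<in> X. \<exists>k>0. (f ^^ k) x = x}"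

definition AY_chaotic :: "'a topology \<Rightarrow> ('a \<times> 'a) filter \<Rightarrow> ('a \<Rightarrow> 'a) \<Rightarrow> bool" where
  "AY_chaotic T \<U> f \<longleftrightarrow> transitive_map T f \<and> sensitive T \<U> f"

definition D_chaotic :: "'a topology \<Rightarrow> ('a \<times> 'a) filter \<Rightarrow> ('a \<Rightarrow> 'a) \<Rightarrow> bool" where
  "D_chaotic T \<U> f \<longleftrightarrow> transitive_map T f \<and> sensitive T \<U> f \<and>
     T closure_of periodic_points (topspace T) f = topspace T"

end

theory Submission
  imports Defs
begin

text \<open>
  In an Alexandroff space every point \<open>x\<close> has a least open neighborhood \<open>M(x)\<close>, which is
  contained in \<open>U(x)\<close> for every entourage \<open>U\<close>, because \<open>U(x)\<close> is a neighborhood of \<open>x\<close>.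
  A continuous \<open>f\<close> maps \<open>M(x)\<close> into \<open>M(f(x))\<close>, so \<open>M(x) \<subseteq> N(x,U)\<close> for every \<open>x\<close> and \<open>U\<close>.
\<close>

text \<open>For \<open>x\<close> outside the space the family is empty and its intersection is
  \<open>UNIV\<close>; cutting down to \<open>topspace T\<close> keeps the value an open set for
  every \<open>x\<close>.\<close>

definition min_nbhd :: "'a topology \<Rightarrow> 'a \<Rightarrow> 'a set" where
  "min_nbhd T x = topspace T \<inter> \<Inter>{V. openin T V \<and> x \<in> V}"

lemma openin_min_nbhd: "Alexandroff_space T \<Longrightarrow> openin T (min_nbhd T x)"
  by (simp add: min_nbhd_def Alexandroff_space_def)

lemma mem_min_nbhd: "x \<in> topspace T \<Longrightarrow> x \<in> min_nbhd T x"
  by (simp add: min_nbhd_def)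

lemma min_nbhd_subset: "openin T V \<Longrightarrow> x \<in> V \<Longrightarrow> min_nbhd T x \<subseteq> V"
  unfolding min_nbhd_def by blast

lemma min_nbhd_subset_topspace: "min_nbhd T x \<subseteq> topspace T"
  by (simp add: min_nbhd_def)

lemma continuous_map_funpow:
  "continuous_map T T f \<Longrightarrow> continuous_map T T (f ^^ k)"
proof (induction k)
  case (Suc k)
  thus ?case
    unfolding funpow.simps by (intro continuous_map_compose)
qed (simp add: id_def)

text \<open>The preimage of the least open neighborhood of \<open>g x\<close> is open and contains
  \<open>x\<close>, hence contains the least one of \<open>x\<close>.\<close>

lemma continuous_map_image_min_nbhd_subset:
  assumes "continuous_map T T' g" "Alexandroff_space T'"
    and "x \<in> topspace T"
  shows "g ` min_nbhd T x \<subseteq> min_nbhd T' (g x)"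
proof -
  let ?V = "{y \<in> topspace T. g y \<in> min_nbhd T' (g x)}"
  have "openin T ?V"
    using assms(1) openin_min_nbhd[OF assms(2)] by (rule openin_continuous_map_preimage)
  moreover have "g x \<in> topspace T'"
    using assms(1,3) by (auto simp: continuous_map_def)
  hence "x \<in> ?V"
    using assms(3) by (simp add: mem_min_nbhd)
  ultimately have "min_nbhd T x \<subseteq> ?V"
    by (rule min_nbhd_subset)
  thus ?thesis by blast
qed

text \<open>Over an empty \<open>X\<close> the filter would lie below
  \<open>principal {} = bot\<close>, against properness. This supplies a point at which to refute
  sensitivity.\<close>

lemma quasi_uniformity_on_nonempty:
  "quasi_uniformity_on X \<U> \<Longrightarrow> X \<noteq> {}"
  by (auto simp: quasi_uniformity_on_def principal_empty le_bot)

text \<open>Only open sets are given by the definition of the topology, so that \<open>U(x)\<close>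
  is a neighborhood of \<open>x\<close> has to be derived from the composition axiom.\<close>

lemma entourage_image_neighborhood:
  assumes "quasi_uniformity_on X \<U>" "U \<in> entourages X \<U>" "x \<in> X"
  obtains V where "openin (quasi_uniform_topology X \<U>) V" "x \<in> V" "V \<subseteq> U `` {x}"
proof
  \<comment> \<open>The candidate for the interior of \<open>U(x)\<close>.\<close>
  let ?V = "{y \<in> X. \<exists>W\<in>entourages X \<U>. W `` {y} \<subseteq> U `` {x}}"
  have refl: "(y, y) \<in> W" if "W \<in> entourages X \<U>" "y \<in> X" for W y
    using assms(1) that unfolding quasi_uniformity_on_def by blast
  show "x \<in> ?V" using assms by blast
  show "?V \<subseteq> U `` {x}" using refl by blast
  have "\<exists>W\<in>entourages X \<U>. W `` {y} \<subseteq> ?V" if "y \<in> ?V" for y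
  proof -
    from that obtain W where W: "W \<in> entourages X \<U>" "W `` {y} \<subseteq> U `` {x}" by blast
    then obtain W' where W': "W' \<in> entourages X \<U>" "W' O W' \<subseteq> W"
      using assms(1) unfolding quasi_uniformity_on_def by blast
    \<comment> \<open>For \<open>z\<close> in \<open>W'(y)\<close>, going from \<open>y\<close>
      through \<open>z\<close> gives \<open>W'(z) \<subseteq> W(y)\<close>; so \<open>W'\<close>
      itself witnesses that \<open>z\<close> lies in \<open>?V\<close>.\<close>
    have "W' `` {z} \<subseteq> U `` {x}" if "z \<in> W' `` {y}" for z
      using W W' that by blast
    moreover have "W' `` {y} \<subseteq> X"
      using W' by (auto simp: entourages_def)
    ultimately show ?thesis using W' by blast
  qed
  thus "openin (quasi_uniform_topology X \<U>) ?V"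
    unfolding openin_quasi_uniform_topology[OF assms(1)] by blast
qed

lemma neighborhood_in_orbit_nbhd:
  assumes A: "Alexandroff_space T" and f: "continuous_map T T f"
    and Q: "quasi_uniformity_on (topspace T) \<U>"
    and T: "quasi_uniform_topology (topspace T) \<U> = T"
    and U: "U \<in> entourages (topspace T) \<U>" and x: "x \<in> topspace T"
  shows "neighborhood_in T x (orbit_nbhd (topspace T) f x U)"
proof -
  have "((f ^^ k) x, (f ^^ k) y) \<in> U" if y: "y \<in> min_nbhd T x" for k y
  proof -
    have fk: "continuous_map T T (f ^^ k)"
      using f by (rule continuous_map_funpow)
    hence "(f ^^ k) x \<in> topspace T"
      using x by (auto simp: continuous_map_def)
    then obtain V where V: "openin T V" "(f ^^ k) x \<in> V" "V \<subseteq> U `` {(f ^^ k) x}"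
      using entourage_image_neighborhood[OF Q U] unfolding T by metis
    \<comment> \<open>The image lemma is applied to the whole iterate, so each \<open>k\<close> is
      handled directly, with no induction along the orbit.\<close>
    have "(f ^^ k) y \<in> min_nbhd T ((f ^^ k) x)"
      using continuous_map_image_min_nbhd_subset[OF fk A x] y by blast
    thus ?thesis
      using min_nbhd_subset[OF V(1,2)] V(3) by blast
  qed
  hence "min_nbhd T x \<subseteq> orbit_nbhd (topspace T) f x U"
    using min_nbhd_subset_topspace[of T x] by (auto simp: orbit_nbhd_def)
  moreover have "orbit_nbhd (topspace T) f x U \<subseteq> topspace T"
    by (auto simp: orbit_nbhd_def)
  ultimately show ?thesis
    unfolding neighborhood_in_def using openin_min_nbhd[OF A, of x] mem_min_nbhd[OF x] by blast
qed

theorem mainTheorem3: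
  fixes T :: "'a topology" and f :: "'a \<Rightarrow> 'a" and \<U> :: "('a \<times> 'a) filter"
  assumes "Alexandroff_space T"
    and "continuous_map T T f"
    and "quasi_uniformity_on (topspace T) \<U>"
    and "quasi_uniform_topology (topspace T) \<U> = T"
  shows "\<not> sensitive T \<U> f \<and> \<not> AY_chaotic T \<U> f \<and> \<not> D_chaotic T \<U> f"
proof -
  have "\<not> sensitive T \<U> f"
    using neighborhood_in_orbit_nbhd[OF assms] quasi_uniformity_on_nonempty[OF assms(3)]
    unfolding sensitive_def by blast
  thus ?thesis
    by (simp add: AY_chaotic_def D_chaotic_def)
qed

end
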